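(* Let $M \geq 1$, let $\tau = (1,2)(3,4)\cdots(2M-1,2M) \in \mathfrak{S}_{2M}$ be a product of $M$ disjoint transpositions, and let $\sigma$ be uniformly distributed in $\mathfrak{S}_{2M}$. Then, as polynomials in $t$, $$\mathbb{E}\left( t^{\mathscr{C}([\sigma,\tau])} \right) = \frac{4^M M!}{(2M)!}\, F_M^+\!\left( t^2/2 \right),$$ which is equivalent to the equality in distribution $$\mathscr{C}([\sigma,\tau]) \stackrel{d}{=} 2\sum_{k=1}^M B_k,$$ where $(B_k)_{k\geq 1}$ is a sequence of independent Bernoulli random variables, $B_k$ having parameter $\frac{1}{2k-1}$ (i.e. $\mathbb{P}(B_k = 1) = \frac{1}{2k-1} = 1 - \mathbb{P}(B_k=0)$).
   Context: $\mathfrak{S}_n$ is the symmetric group on $\{1,\dots,n\}$. For a permutation $\pi$, $\mathscr{C}(\pi)$ denotes its number of cycles, fixed points being counted as cycles of length $1$. The commutator is $[\sigma,\tau] = \sigma\tau\sigma^{-1}\tau^{-1}$. The rising factorial polynomial is $F_n^+(X) = X(X+1)\cdots(X+n-1)$, with $F_0^+ = 1$. *)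

theory Defs
  imports
    "HOL-Probability.Probability"
    "HOL-Combinatorics.Orbits"
    "HOL-Computational_Algebra.Polynomial"
begin

text \<open>Permutations of \<open>{1..n}\<close> are functions \<open>p :: nat \<Rightarrow> nat\<close> with \<open>p permutes {1..n}\<close>
  (so they fix every point outside \<open>{1..n}\<close>); the group operation is composition.\<close>

definition commutator :: "('a \<Rightarrow> 'a) \<Rightarrow> ('a \<Rightarrow> 'a) \<Rightarrow> 'a \<Rightarrow> 'a" where
  "commutator \<sigma> \<tau> = \<sigma> \<circ> \<tau> \<circ> inv \<sigma> \<circ> inv \<tau>"

text \<open>The supports of the cycles of a permutation of \<open>S\<close>, fixed points in \<open>S\<close> included, are its
  orbits on \<open>S\<close>.\<close>

definition num_cycles :: "'a set \<Rightarrow> ('a \<Rightarrow> 'a) \<Rightarrow> nat" where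
  "num_cycles S p = card (orbit p ` S)"

definition pair_involution :: "nat \<Rightarrow> nat \<Rightarrow> nat" where
  "pair_involution M = foldr (\<circ>) (map (\<lambda>k. Transposition.transpose (2 * k - 1) (2 * k)) [1..<Suc M]) id"

definition uniform_perm :: "nat \<Rightarrow> (nat \<Rightarrow> nat) pmf" where
  "uniform_perm n = pmf_of_set {p. p permutes {1..n}}"

definition rising_factorial_poly :: "nat \<Rightarrow> real poly" where
  "rising_factorial_poly n = (\<Prod>i<n. [:of_nat i, 1:])"

text \<open>Expectation of a random polynomial. The type \<open>real poly\<close> is not a Banach space, so the
  Bochner integral is not available on it; the definition is meant for distributions of finite
  support, where it agrees with the usual expectation at each argument.\<close>

definition expectation_poly :: "'a pmf \<Rightarrow> ('a \<Rightarrow> real poly) \<Rightarrow> real poly" where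
  "expectation_poly p f = (\<Sum>x\<in>set_pmf p. smult (pmf p x) (f x))"

lemma poly_expectation_poly:
  assumes "finite (set_pmf p)"
  shows "poly (expectation_poly p f) t = measure_pmf.expectation p (\<lambda>x. poly (f x) t)"
  using assms
  by (subst integral_measure_pmf[of "set_pmf p"]) (auto simp: expectation_poly_def poly_sum)

lemma finite_set_pmf_uniform_perm: "finite (set_pmf (uniform_perm n))"
proof -
  have "id \<in> {p. p permutes {1..n}}"
    by (simp only: mem_Collect_eq permutes_id)
  moreover have "finite {p. p permutes {1..n}}"
    by (intro finite_permutations) simp
  ultimately have "{p. p permutes {1..n}} \<noteq> {}" "finite {p. p permutes {1..n}}"
    by blast+
  then show ?thesis
    unfolding uniform_perm_def by (subst set_pmf_of_set)
qed

end

theory Submission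
  imports Defs
begin

text \<open>
  Write \<open>\<tau>\<close> for the given product of transpositions. As \<open>\<tau>\<close> is its own inverse, the commutator is
  \<open>(\<sigma> \<circ> \<tau> \<circ> inv \<sigma>) \<circ> \<tau>\<close>, a product of two involutions without fixed points. All such involutions
  of a finite set are conjugate (\<open>fpf_involutions_conjugate\<close>), and the fibres of
  \<open>\<sigma> \<mapsto> \<sigma> \<circ> \<tau> \<circ> inv \<sigma>\<close> are cosets of the centraliser of \<open>\<tau>\<close>, so the conjugate of \<open>\<tau>\<close> by a uniform
  \<open>\<sigma>\<close> is a uniform fixed-point-free involution \<open>p\<close> (\<open>sum_conjugates\<close>). It remains to count the
  involutions \<open>p\<close> by the number of cycles of \<open>p \<circ> \<tau>\<close>.

  This is done by removing one pair \<open>a\<close>, \<open>b = \<tau> a\<close> of \<open>\<tau>\<close>. On a set of \<open>2 * (m + 1)\<close> points, \<open>p\<close> is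
  determined by the partner \<open>c\<close> of \<open>a\<close> and by a fixed-point-free involution \<open>\<rho>\<close> of the
  \<open>2 * m\<close> points other than \<open>a\<close> and \<open>b\<close>. If \<open>c = b\<close>, then \<open>a\<close> and \<open>b\<close> are fixed points of \<open>p \<circ> \<tau>\<close> and
  contribute two cycles; for each of the other \<open>2 * m\<close> choices of \<open>c\<close>, the points \<open>a\<close> and \<open>b\<close> are
  merely inserted into existing cycles (\<open>num_cycles_remove_pair\<close>). In terms of the generating
  polynomial in \<open>t\<close>, this multiplies by \<open>t\<^sup>2 + 2 * m\<close>
  (\<open>sum_monom_num_cycles_fpf_involutions\<close>). At \<open>t = 1\<close> the product is the number
  \<open>1 * 3 * \<dots> * (2 * M - 1)\<close> of fixed-point-free involutions, so the expectation is the product of the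
  factors \<open>(t\<^sup>2 + 2 * k) / (2 * k + 1)\<close> for \<open>k < M\<close>.

  Each factor is the probability generating polynomial of twice a Bernoulli variable with parameter
  \<open>1 / (2 * k + 1)\<close>, and generating polynomials of independent variables multiply
  (\<open>prob_sum_eq_coeff_prod\<close>). Comparing coefficients gives the equality of laws.
\<close>

text \<open>The name \<open>transpose\<close> alone would denote the transposition of matrices.\<close>

abbreviation transposition :: "'a \<Rightarrow> 'a \<Rightarrow> 'a \<Rightarrow> 'a" where
  "transposition \<equiv> Transposition.transpose"

section \<open>Removing points from the cycles of a permutation\<close>

text \<open>Composing with the transposition of \<open>a\<close> and \<open>p a\<close> on the left redirects the predecessor of \<open>a\<close>
  to \<open>p a\<close> and makes \<open>a\<close> a fixed point: \<open>a\<close> is cut out of its cycle, and nothing else changes.\<close>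

lemma orbit_bypass:
  assumes "inj p" "p a \<noteq> a" "x \<noteq> a"
  shows "orbit (transposition a (p a) \<circ> p) x = orbit p x - {a}"
proof (intro equalityI subsetI)
  define q where "q = transposition a (p a) \<circ> p"
  have q: "q z = (if p z = a then p a else p z)" if "z \<noteq> a" for z
    using that assms by (auto simp: q_def Transposition.transpose_def inj_eq)
  {
    fix y assume "y \<in> orbit (transposition a (p a) \<circ> p) x"
    then have "y \<in> orbit q x" by (simp only: q_def)
    then have "y \<in> orbit p x \<and> y \<noteq> a"
    proof induction
      case base
      show ?case
        using assms orbit.base[of p x] orbit.step[of "p x" p x] by (auto simp: q)
    next
      case (step z)
      then show ?case
        using assms orbit.step[of z p x] orbit.step[of "p z" p x] by (auto simp: q)
    qed
    then show "y \<in> orbit p x - {a}" by simp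
  }
  {
    fix y assume "y \<in> orbit p x - {a}"
    then have "y \<in> orbit p x" "y \<noteq> a" by auto
    \<comment> \<open>The walk of \<open>p\<close> may pass through \<open>a\<close>, where the walk of \<open>q\<close> is already one step ahead.\<close>
    from this(1) have "(if y = a then p a else y) \<in> orbit q x"
    proof induction
      case base
      show ?case using orbit.base[of q x] by (simp add: q[OF assms(3)])
    next
      case (step z)
      show ?case
      proof (cases "z = a")
        case True
        then show ?thesis using step assms by simp
      next
        case False
        then have "q z \<in> orbit q x" using step orbit.step[of z q x] by simp
        then show ?thesis by (simp add: q[OF False])
      qed
    qed
    with \<open>y \<noteq> a\<close> show "y \<in> orbit (transposition a (p a) \<circ> p) x" by (simp add: q_def)
  }
qed

text \<open>Cutting \<open>a\<close> out of its cycle destroys that cycle exactly when it consists of \<open>a\<close> alone.\<close>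

lemma num_cycles_bypass:
  assumes "finite A" "p permutes A" "a \<in> A"
  shows "num_cycles A p
    = num_cycles (A - {a}) (transposition a (p a) \<circ> p) + (if p a = a then 1 else 0)"
proof -
  have perm: "permutation p" using assms by (auto simp: permutation_permutes)
  note self = permutation_self_in_orbit[OF perm]
  have inj: "inj p" using assms(2) by (rule permutes_inj)
  have A: "A = insert a (A - {a})" using assms by auto
  have eqI: "orbit p x = orbit p y" if "x \<in> orbit p y" for x y
    using orbit_cyclic_eq3[OF cyclic_on_orbit'[OF perm] that] .
  show ?thesis
  proof (cases "p a = a")
    case True
    then have "orbit p a = {a}" by (simp add: orbit_eq_singleton_iff)
    moreover have "{a} \<notin> orbit p ` (A - {a})"
      using self by force
    ultimately have "num_cycles A p = Suc (num_cycles (A - {a}) p)"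
      using assms(1) by (subst num_cycles_def, subst A, unfold image_insert) (simp add: num_cycles_def)
    then show ?thesis using True by simp
  next
    case False
    have pa: "p a \<in> A - {a}" using False assms permutes_in_image[of p A a] by auto
    have "orbit p a = orbit p (p a)"
      using eqI[OF orbit.base[of p a]] by simp
    then have "orbit p ` A = orbit p ` (A - {a})"
      using pa by (subst A) auto
    moreover have "orbit (transposition a (p a) \<circ> p) ` (A - {a})
        = (\<lambda>X. X - {a}) ` (orbit p ` (A - {a}))"
      unfolding image_image using orbit_bypass[OF inj False] by (intro image_cong) auto
    moreover have "inj_on (\<lambda>X. X - {a}) (orbit p ` (A - {a}))"
    proof (rule inj_onI)
      fix X Y assume "X \<in> orbit p ` (A - {a})" "Y \<in> orbit p ` (A - {a})"
        and eq: "X - {a} = Y - {a}"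
      then obtain x y where xy: "x \<noteq> a" "X = orbit p x" "Y = orbit p y" by auto
      then have "x \<in> orbit p y" using self[of x] eq by blast
      then show "X = Y" unfolding xy by (rule eqI)
    qed
    ultimately show ?thesis using False
      by (simp add: num_cycles_def card_image)
  qed
qed

section \<open>Fixed-point-free involutions\<close>

definition fpf_involutions :: "'a set \<Rightarrow> ('a \<Rightarrow> 'a) set" where
  "fpf_involutions A = {p. p permutes A \<and> p \<circ> p = id \<and> (\<forall>x\<in>A. p x \<noteq> x)}"

lemma fpf_involutionsD:
  assumes "p \<in> fpf_involutions A"
  shows "p permutes A" "\<And>x. p (p x) = x" "\<And>x. x \<in> A \<Longrightarrow> p x \<noteq> x"
    "\<And>x. x \<notin> A \<Longrightarrow> p x = x" "\<And>x. p x \<in> A \<longleftrightarrow> x \<in> A" "inv p = p" "\<And>x y. p x = p y \<longleftrightarrow> x = y"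
proof -
  show p: "p permutes A" and pp: "\<And>x. p (p x) = x" and "\<And>x. x \<in> A \<Longrightarrow> p x \<noteq> x"
    using assms by (auto simp: fpf_involutions_def fun_eq_iff)
  show "\<And>x. x \<notin> A \<Longrightarrow> p x = x" "\<And>x. p x \<in> A \<longleftrightarrow> x \<in> A"
    using p by (auto simp: permutes_not_in permutes_in_image)
  show "inv p = p" using pp by (intro inv_unique_comp) (auto simp: fun_eq_iff)
  show "\<And>x y. p x = p y \<longleftrightarrow> x = y" using pp by metis
qed

lemma fpf_involutionsI:
  assumes "\<And>x. p (p x) = x" "\<And>x. x \<in> A \<Longrightarrow> p x \<noteq> x" "\<And>x. x \<notin> A \<Longrightarrow> p x = x"
  shows "p \<in> fpf_involutions A"
proof -
  have "p permutes A" unfolding permutes_def using assms by metis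
  then show ?thesis using assms by (auto simp: fpf_involutions_def)
qed

lemma finite_fpf_involutions: "finite A \<Longrightarrow> finite (fpf_involutions A)"
  unfolding fpf_involutions_def by (rule finite_subset[OF _ finite_permutations]) auto

lemma fpf_involutions_empty: "fpf_involutions {} = {id}"
  by (auto simp: fpf_involutions_def)

lemma fpf_involutions_conj:
  assumes "p \<in> fpf_involutions A" "\<sigma> permutes A"
  shows "\<sigma> \<circ> p \<circ> inv \<sigma> \<in> fpf_involutions A"
proof (rule fpf_involutionsI)
  note p = fpf_involutionsD[OF assms(1)]
  note inv = permutes_inverses[OF assms(2)]
  show "(\<sigma> \<circ> p \<circ> inv \<sigma>) ((\<sigma> \<circ> p \<circ> inv \<sigma>) x) = x" for x
    by (simp add: inv p)
  show "(\<sigma> \<circ> p \<circ> inv \<sigma>) x \<noteq> x" if "x \<in> A" for x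
    using p(3)[of "inv \<sigma> x"] that inv permutes_in_image[OF permutes_inv[OF assms(2)], of x]
    by (metis comp_apply)
  show "(\<sigma> \<circ> p \<circ> inv \<sigma>) x = x" if "x \<notin> A" for x
    using p(4)[of "inv \<sigma> x"] that inv permutes_in_image[OF permutes_inv[OF assms(2)], of x]
    by (metis comp_apply)
qed

lemma fpf_involutions_add_pair:
  assumes "p \<in> fpf_involutions A" "a \<notin> A" "b \<notin> A" "a \<noteq> b"
  shows "transposition a b \<circ> p \<in> fpf_involutions (insert a (insert b A))"
  using fpf_involutionsD(2-5)[OF assms(1)] assms(2-)
  by (intro fpf_involutionsI) (auto simp: Transposition.transpose_def)

lemma fpf_involutions_remove_pair:
  assumes "p \<in> fpf_involutions A" "a \<in> A" "p a = b"
  shows "transposition a b \<circ> p \<in> fpf_involutions (A - {a, b})"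
proof -
  note p = fpf_involutionsD(2-5,7)[OF assms(1)]
  have pb: "p b = a" using p(1)[of a] assms by simp
  then have *: "p x = a \<longleftrightarrow> x = b" "p x = b \<longleftrightarrow> x = a" for x using p(1) assms(3) by metis+
  have "a \<noteq> b" using p(2)[of a] assms by auto
  then show ?thesis
    using p assms pb by (intro fpf_involutionsI) (auto simp: Transposition.transpose_def *)
qed

text \<open>Induction on the set: after conjugating \<open>q\<close> by a transposition, \<open>p\<close> and \<open>q\<close> agree on one pair
  \<open>a\<close>, \<open>b\<close>. A conjugator of the two rests fixes \<open>a\<close> and \<open>b\<close>, so it commutes with their
  transposition and also conjugates the whole involutions.\<close>

lemma fpf_involutions_conjugate:
  assumes "finite A" "p \<in> fpf_involutions A" "q \<in> fpf_involutions A"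
  shows "\<exists>\<sigma>. \<sigma> permutes A \<and> \<sigma> \<circ> p = q \<circ> \<sigma>"
  using assms
proof (induction A arbitrary: p q rule: finite_psubset_induct)
  case (psubset A)
  show ?case
  proof (cases "A = {}")
    case True
    with psubset.prems show ?thesis by (auto simp: fpf_involutions_empty)
  next
    case False
    then obtain a where a: "a \<in> A" by auto
    note p = fpf_involutionsD[OF psubset.prems(1)] and q = fpf_involutionsD[OF psubset.prems(2)]
    define b where "b = p a"
    have b: "b \<in> A" "b \<noteq> a" using p(5)[of a] p(3)[of a] a by (auto simp: b_def)
    define T where "T = transposition b (q a)"
    have T: "T permutes A" "T \<circ> T = id" "inv T = T"
      using b a q(5)[of a] by (auto simp: T_def intro!: permutes_swap_id)
    define q' where "q' = T \<circ> q \<circ> T"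
    have q': "q' \<in> fpf_involutions A"
      using fpf_involutions_conj[OF psubset.prems(2) T(1)] by (simp add: q'_def T)
    have "q' a = b"
      using b a q(3)[OF a] by (simp add: q'_def T_def)
    let ?t = "transposition a b"
    have "?t \<circ> p \<in> fpf_involutions (A - {a, b})" "?t \<circ> q' \<in> fpf_involutions (A - {a, b})"
      using fpf_involutions_remove_pair[OF psubset.prems(1) a] 
        fpf_involutions_remove_pair[OF q' a \<open>q' a = b\<close>] by (auto simp: b_def)
    then obtain \<sigma> where \<sigma>: "\<sigma> permutes A - {a, b}" "\<sigma> \<circ> (?t \<circ> p) = (?t \<circ> q') \<circ> \<sigma>"
      using psubset.IH[of "A - {a, b}"] a by blast
    have fixed: "\<sigma> a = a" "\<sigma> b = b" using permutes_not_in[OF \<sigma>(1)] by auto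
    then have ab: "\<sigma> x = a \<longleftrightarrow> x = a" "\<sigma> x = b \<longleftrightarrow> x = b" for x
      using permutes_inj[OF \<sigma>(1)] by (metis injD)+
    have "\<sigma> \<circ> ?t = ?t \<circ> \<sigma>" by (auto simp: fun_eq_iff Transposition.transpose_def ab fixed)
    then have "?t \<circ> (\<sigma> \<circ> p) = ?t \<circ> (q' \<circ> \<sigma>)" using \<sigma>(2) by (simp add: o_assoc)
    then have "\<sigma> \<circ> p = q' \<circ> \<sigma>"
      by (simp add: fun_eq_iff) (metis transpose_involutory)
    then have "T \<circ> \<sigma> \<circ> p = T \<circ> T \<circ> q \<circ> (T \<circ> \<sigma>)"
      by (simp add: q'_def o_assoc[symmetric])
    then have "T \<circ> \<sigma> \<circ> p = q \<circ> (T \<circ> \<sigma>)" by (simp add: T)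
    moreover have "T \<circ> \<sigma> permutes A"
      using T(1) \<sigma>(1) by (blast intro: permutes_compose permutes_subset)
    ultimately show ?thesis by blast
  qed
qed

text \<open>Uniformity of a random conjugate: the permutations conjugating \<open>\<tau>\<close> into \<open>p\<close> form the coset
  \<open>\<rho> \<circ> C\<close> of the centraliser \<open>C\<close> of \<open>\<tau>\<close>, where \<open>\<rho>\<close> is any one of them. Hence each \<open>p\<close> is attained
  equally often.\<close>

lemma sum_conjugates:
  fixes g :: "('a \<Rightarrow> 'a) \<Rightarrow> 'b :: semiring_1"
  assumes "finite A" "\<tau> \<in> fpf_involutions A"
  shows "(\<Sum>\<sigma> | \<sigma> permutes A. g (\<sigma> \<circ> \<tau> \<circ> inv \<sigma>))
    = of_nat (card {\<sigma>. \<sigma> permutes A \<and> \<sigma> \<circ> \<tau> = \<tau> \<circ> \<sigma>}) * (\<Sum>p\<in>fpf_involutions A. g p)"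
proof -
  let ?S = "{\<sigma>. \<sigma> permutes A}" and ?C = "{\<sigma>. \<sigma> permutes A \<and> \<sigma> \<circ> \<tau> = \<tau> \<circ> \<sigma>}"
  have fin: "finite ?S" using assms by (simp add: finite_permutations)
  have fibre: "card {\<sigma> \<in> ?S. \<sigma> \<circ> \<tau> \<circ> inv \<sigma> = p} = card ?C" if p: "p \<in> fpf_involutions A" for p
  proof -
    obtain \<rho> where \<rho>: "\<rho> permutes A" "\<rho> \<circ> \<tau> = p \<circ> \<rho>"
      using fpf_involutions_conjugate[OF assms p] by blast
    note inv = permutes_inv_o[OF \<rho>(1)]
    have iff: "\<sigma> \<circ> \<tau> \<circ> inv \<sigma> = p \<longleftrightarrow> \<sigma> \<circ> \<tau> = p \<circ> \<sigma>" if "\<sigma> permutes A" for \<sigma>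
      using permutes_inverses[OF that] by (auto simp: fun_eq_iff) (metis)
    have "bij_betw (\<lambda>\<sigma>. \<rho> \<circ> \<sigma>) ?C {\<sigma> \<in> ?S. \<sigma> \<circ> \<tau> \<circ> inv \<sigma> = p}"
    proof (rule bij_betw_byWitness[where f' = "\<lambda>\<sigma>. inv \<rho> \<circ> \<sigma>"])
      show "\<forall>\<sigma>\<in>?C. inv \<rho> \<circ> (\<rho> \<circ> \<sigma>) = \<sigma>"
        "\<forall>\<sigma>\<in>{\<sigma> \<in> ?S. \<sigma> \<circ> \<tau> \<circ> inv \<sigma> = p}. \<rho> \<circ> (inv \<rho> \<circ> \<sigma>) = \<sigma>"
        using inv by (auto simp: o_assoc)
      show "(\<circ>) \<rho> ` ?C \<subseteq> {\<sigma> \<in> ?S. \<sigma> \<circ> \<tau> \<circ> inv \<sigma> = p}"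
      proof clarify
        fix \<sigma> assume \<sigma>: "\<sigma> permutes A" "\<sigma> \<circ> \<tau> = \<tau> \<circ> \<sigma>"
        have perm: "\<rho> \<circ> \<sigma> permutes A" using \<sigma> \<rho> by (blast intro: permutes_compose)
        have "\<rho> \<circ> \<sigma> \<circ> \<tau> = p \<circ> (\<rho> \<circ> \<sigma>)" using \<rho>(2) \<sigma>(2) by (simp add: fun_eq_iff)
        with perm iff[OF perm] show "\<rho> \<circ> \<sigma> \<in> ?S \<and> \<rho> \<circ> \<sigma> \<circ> \<tau> \<circ> inv (\<rho> \<circ> \<sigma>) = p" by blast
      qed
      show "(\<circ>) (inv \<rho>) ` {\<sigma> \<in> ?S. \<sigma> \<circ> \<tau> \<circ> inv \<sigma> = p} \<subseteq> ?C"
      proof clarify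
        fix \<sigma> assume \<sigma>: "\<sigma> permutes A" "p = \<sigma> \<circ> \<tau> \<circ> inv \<sigma>"
        have "\<sigma> \<circ> \<tau> = p \<circ> \<sigma>" using iff[OF \<sigma>(1)] \<sigma>(2) by simp
        moreover have "inv \<rho> \<circ> p = \<tau> \<circ> inv \<rho>" using \<rho>(2) permutes_inverses[OF \<rho>(1)] by (simp add: fun_eq_iff) metis
        ultimately have "inv \<rho> \<circ> \<sigma> \<circ> \<tau> = \<tau> \<circ> (inv \<rho> \<circ> \<sigma>)" by (simp add: fun_eq_iff)
        then show "inv \<rho> \<circ> \<sigma> permutes A \<and> inv \<rho> \<circ> \<sigma> \<circ> \<tau> = \<tau> \<circ> (inv \<rho> \<circ> \<sigma>)"
          using \<sigma>(1) permutes_inv[OF \<rho>(1)] by (blast intro: permutes_compose)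
      qed
    qed
    then show ?thesis by (simp add: bij_betw_same_card)
  qed
  have "(\<Sum>\<sigma>\<in>?S. g (\<sigma> \<circ> \<tau> \<circ> inv \<sigma>))
      = (\<Sum>p\<in>fpf_involutions A. \<Sum>\<sigma>\<in>{\<sigma> \<in> ?S. \<sigma> \<circ> \<tau> \<circ> inv \<sigma> = p}. g (\<sigma> \<circ> \<tau> \<circ> inv \<sigma>))"
    using fin finite_fpf_involutions[OF assms(1)] fpf_involutions_conj[OF assms(2)]
    by (intro sum.group[symmetric]) auto
  also have "\<dots> = (\<Sum>p\<in>fpf_involutions A. of_nat (card ?C) * g p)"
    using fibre by (intro sum.cong refl) simp
  finally show ?thesis by (simp add: sum_distrib_left)
qed

section \<open>Counting the cycles of a product of two fixed-point-free involutions\<close>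

text \<open>The involutions that pair \<open>a\<close> with \<open>b\<close> are the \<open>transposition a b \<circ> \<rho>\<close>. Conjugating by the
  transposition of \<open>b\<close> and \<open>c\<close> turns the partner of \<open>a\<close> from \<open>b\<close> into \<open>c\<close>; for \<open>c = b\<close> this is the
  identity, so that all partners are treated by one formula.\<close>

lemma fpf_involutions_bij_betw_remove_pair:
  assumes "a \<notin> A" "b \<notin> A" "a \<noteq> b"
  shows "bij_betw (\<lambda>(c, \<rho>). transposition b c \<circ> (transposition a b \<circ> \<rho>) \<circ> transposition b c)
    (insert b A \<times> fpf_involutions A) (fpf_involutions (insert a (insert b A)))"
proof (rule bij_betw_byWitness[where
      f' = "\<lambda>p. (p a, transposition a b \<circ> (transposition b (p a) \<circ> p \<circ> transposition b (p a)))"])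
  let ?A = "insert a (insert b A)"
  let ?f = "\<lambda>(c, \<rho>). transposition b c \<circ> (transposition a b \<circ> \<rho>) \<circ> transposition b c"
  let ?g = "\<lambda>p. (p a, transposition a b \<circ> (transposition b (p a) \<circ> p \<circ> transposition b (p a)))"
  have val: "?f (c, \<rho>) a = c" if "c \<in> insert b A" "\<rho> \<in> fpf_involutions A" for c \<rho>
    using that(1) fpf_involutionsD(4)[OF that(2) assms(1)] assms
    by (cases "c = b") (auto simp: Transposition.transpose_def)
  show "\<forall>x\<in>insert b A \<times> fpf_involutions A. ?g (?f x) = x"
  proof
    fix x assume "x \<in> insert b A \<times> fpf_involutions A"
    then obtain c \<rho> where *: "c \<in> insert b A" "\<rho> \<in> fpf_involutions A" and x: "x = (c, \<rho>)"
      by auto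
    show "?g (?f x) = x"
      unfolding x val[OF *] by (simp add: fun_eq_iff)
  qed
  show "\<forall>p\<in>fpf_involutions ?A. ?f (?g p) = p"
    by (simp add: fun_eq_iff)
  show "?f ` (insert b A \<times> fpf_involutions A) \<subseteq> fpf_involutions ?A"
  proof clarify
    fix c \<rho> assume *: "c \<in> insert b A" "\<rho> \<in> fpf_involutions A"
    have "transposition b c permutes ?A" using * by (intro permutes_swap_id) auto
    from fpf_involutions_conj[OF fpf_involutions_add_pair[OF *(2) assms] this]
    show "transposition b c \<circ> (transposition a b \<circ> \<rho>) \<circ> transposition b c \<in> fpf_involutions ?A" by simp
  qed
  show "?g ` fpf_involutions ?A \<subseteq> insert b A \<times> fpf_involutions A"
  proof clarify
    fix p assume p: "p \<in> fpf_involutions ?A"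
    note pD = fpf_involutionsD[OF p]
    have pa: "p a \<in> insert b A" using pD(3,5)[of a] by auto
    let ?T = "transposition b (p a)"
    have "?T permutes ?A" using pa by (intro permutes_swap_id) auto
    from fpf_involutions_conj[OF p this] have "?T \<circ> p \<circ> ?T \<in> fpf_involutions ?A" by simp
    moreover have "(?T \<circ> p \<circ> ?T) a = b" using assms pD(3)[of a] by simp
    ultimately have "transposition a b \<circ> (?T \<circ> p \<circ> ?T) \<in> fpf_involutions (?A - {a, b})"
      by (intro fpf_involutions_remove_pair) auto
    also have "?A - {a, b} = A" using assms by auto
    finally show "p a \<in> insert b A \<and> transposition a b \<circ> (?T \<circ> p \<circ> ?T) \<in> fpf_involutions A"
      using pa by blast
  qed
qed

text \<open>The points \<open>a\<close> and then \<open>b\<close> are cut out of the cycles of \<open>r = p \<circ> (transposition a b \<circ> \<tau>)\<close>; in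
  either case for \<open>c\<close>, what is left is \<open>\<rho> \<circ> \<tau>\<close>. For \<open>c = b\<close> both are fixed points, hence cycles of
  their own. For \<open>c \<noteq> b\<close> and \<open>d = \<rho> c\<close>, the involution \<open>p\<close> has the pairs \<open>a\<close>, \<open>c\<close> and \<open>b\<close>, \<open>d\<close> where
  \<open>\<rho>\<close> has the pair \<open>c\<close>, \<open>d\<close>, so \<open>r\<close> reaches \<open>d\<close> from the \<open>\<tau>\<close>-partner of \<open>c\<close> by way of \<open>a\<close>, and \<open>c\<close>
  from the \<open>\<tau>\<close>-partner of \<open>d\<close> by way of \<open>b\<close>, where \<open>\<rho> \<circ> \<tau>\<close> gets there in one step.\<close>

lemma num_cycles_remove_pair:
  assumes "finite A" "a \<notin> A" "b \<notin> A" "a \<noteq> b" "c \<in> insert b A"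
    and "\<rho> \<in> fpf_involutions A" "\<tau> \<in> fpf_involutions A"
  defines "p \<equiv> transposition b c \<circ> (transposition a b \<circ> \<rho>) \<circ> transposition b c"
  shows "num_cycles (insert a (insert b A)) (p \<circ> (transposition a b \<circ> \<tau>))
    = num_cycles A (\<rho> \<circ> \<tau>) + (if c = b then 2 else 0)"
proof -
  let ?A = "insert a (insert b A)"
  define r where "r = p \<circ> (transposition a b \<circ> \<tau>)"
  define r' where "r' = transposition a (r a) \<circ> r"
  define r'' where "r'' = transposition b (r' b) \<circ> r'"
  note \<rho> = fpf_involutionsD[OF assms(6)] and \<tau> = fpf_involutionsD[OF assms(7)]
  have "p \<in> fpf_involutions ?A"
    using fpf_involutions_bij_betw_remove_pair[OF assms(2-4)] assms(5,6)
    by (force simp: p_def bij_betw_def)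
  then have perm: "r permutes ?A"
    unfolding r_def using fpf_involutions_add_pair[OF assms(7,2-4)] fpf_involutionsD(1)
    by (blast intro: permutes_compose)
  then have ra: "r a \<in> ?A" using permutes_in_image[of r ?A a] by simp
  then have "transposition a (r a) permutes ?A" by (intro permutes_swap_id) auto
  then have "r' permutes ?A" unfolding r'_def using perm by (blast intro: permutes_compose)
  then have perm': "r' permutes (insert b A)"
    by (rule permutes_superset) (auto simp: r'_def)
  have "?A - {a} = insert b A" "insert b A - {b} = A" using assms(2-4) by auto
  then have "num_cycles ?A r = num_cycles A r'' + (if r' b = b then 1 else 0) + (if r a = a then 1 else 0)"
    using num_cycles_bypass[OF _ perm, of a] num_cycles_bypass[OF _ perm', of b] assms(1)
    by (simp add: r'_def[symmetric] r''_def[symmetric])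
  moreover have "r'' = \<rho> \<circ> \<tau> \<and> (r a = a \<longleftrightarrow> c = b) \<and> (r' b = b \<longleftrightarrow> c = b)"
  proof (cases "c = b")
    case True
    then have p: "p = transposition a b \<circ> \<rho>" by (simp add: p_def)
    have outside: "\<rho> x = x" "\<tau> x = x" if "x \<notin> A" for x using that \<rho>(4) \<tau>(4) by auto
    have inside: "transposition a b x = x" if "x \<in> A" for x
      using that assms(2,3) by (metis transpose_apply_other)
    have "r x = \<rho> (\<tau> x)" for x
    proof (cases "x \<in> A")
      case True
      then have "\<tau> x \<in> A" "\<rho> (\<tau> x) \<in> A" using \<rho>(5) \<tau>(5) by auto
      then show ?thesis by (simp add: r_def p inside)
    next
      case False
      moreover have "transposition a b x \<notin> A"
        using False assms(2,3) by (simp add: Transposition.transpose_def)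
      ultimately show ?thesis by (simp add: r_def p outside)
    qed
    then have r: "r = \<rho> \<circ> \<tau>" by (simp add: fun_eq_iff)
    have "r a = a" "r b = b" using \<rho>(4) \<tau>(4) assms(2,3) by (auto simp: r)
    then show ?thesis using True by (simp add: r r'_def r''_def)
  next
    case False
    then have c: "c \<in> A" using assms by simp
    define d where "d = \<rho> c"
    have d: "d \<in> A" "d \<noteq> c" "\<rho> d = c" using \<rho> c by (auto simp: d_def)
    have fixed: "\<rho> a = a" "\<rho> b = b" "\<tau> a = a" "\<tau> b = b" using \<rho>(4) \<tau>(4) assms(2,3) by auto
    have ne: "a \<noteq> c" "a \<noteq> d" "b \<noteq> c" "b \<noteq> d" using c d assms(2,3) by auto
    have inA: "x \<noteq> a \<and> x \<noteq> b" if "x \<in> A" for x using that assms by auto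
    have p_vals: "p a = c" "p c = a" "p b = d" "p d = b"
      using ne d fixed assms(4) by (auto simp: p_def d_def[symmetric])
    have \<rho>_eq: "\<rho> x = c \<longleftrightarrow> x = d" "\<rho> x = d \<longleftrightarrow> x = c" for x using \<rho>(2) d by metis+
    have p_other: "p x = \<rho> x" if "x \<notin> {a, b, c, d}" for x
      using that inA[of x] inA[of "\<rho> x"] \<rho>(4,5)[of x] \<rho>_eq[of x]
      by (cases "x \<in> A") (auto simp: p_def)
    have ra: "r a = d" using fixed p_vals by (simp add: r_def)
    have rb: "r b = c" using fixed p_vals by (simp add: r_def)
    have r'b: "r' b = c" using ra rb ne d by (simp add: r'_def)
    have r'': "r'' x = transposition b c (transposition a d (r x))" for x
      unfolding r''_def comp_apply r'b by (simp add: r'_def ra)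
    have "r'' x = \<rho> (\<tau> x)" for x
    proof (cases "x \<in> A")
      case True
      then have t: "\<tau> x \<in> A" "\<tau> x \<noteq> a" "\<tau> x \<noteq> b" using \<tau>(5) inA by auto
      have rx: "r x = p (\<tau> x)" using t by (simp add: r_def)
      consider "\<tau> x = c" | "\<tau> x = d" | "\<tau> x \<notin> {a, b, c, d}" using t by auto
      then show ?thesis
      proof cases
        case 1
        then show ?thesis using ne d p_vals by (simp add: r'' rx d_def[symmetric])
      next
        case 2
        then show ?thesis using ne d p_vals assms(4) by (simp add: r'' rx)
      next
        case 3
        have "\<rho> (\<tau> x) \<notin> {a, b, c, d}"
          using 3 \<rho>_eq \<rho>(5)[of "\<tau> x"] t(1) assms(2,3) by auto
        then show ?thesis using p_other[OF 3] by (simp add: r'' rx)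
      qed
    next
      case False
      then consider "x = a" | "x = b" | "x \<notin> ?A" by auto
      then show ?thesis
      proof cases
        case 1 then show ?thesis using fixed ne assms(4) by (simp add: r'' ra)
      next
        case 2 then show ?thesis using rb fixed ne d(2) assms(4) by (simp add: r'')
      next
        case 3
        then have "x \<noteq> c" "x \<noteq> d" "x \<noteq> a" "x \<noteq> b" using c d by auto
        moreover have "r x = x" using 3 permutes_not_in[OF perm] by blast
        ultimately show ?thesis using \<rho>(4) \<tau>(4) 3 by (simp add: r'')
      qed
    qed
    then show ?thesis using ra r'b ne False by (auto simp: fun_eq_iff)
  qed
  ultimately show ?thesis by (simp add: r_def)
qed

text \<open>The factor \<open>t\<^sup>2 + 2 * m\<close> of the induction step sums over the partner \<open>c\<close> of a point \<open>a\<close>: the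
  choice \<open>c = \<tau> a\<close> creates two cycles, the other \<open>2 * m\<close> choices create none.\<close>

lemma sum_monom_num_cycles_fpf_involutions:
  assumes "finite A" "card A = 2 * m" "\<tau> \<in> fpf_involutions A"
  shows "(\<Sum>p\<in>fpf_involutions A. monom 1 (num_cycles A (p \<circ> \<tau>)))
    = (\<Prod>k<m. monom 1 2 + [:2 * of_nat k:] :: 'b :: comm_semiring_1 poly)"
  using assms
proof (induction m arbitrary: A \<tau>)
  case 0
  then show ?case by (simp add: fpf_involutions_empty num_cycles_def)
next
  case (Suc m)
  then obtain a where a: "a \<in> A" by fastforce
  define b where "b = \<tau> a"
  define A' where "A' = A - {a, b}"
  define \<tau>' where "\<tau>' = transposition a b \<circ> \<tau>"
  have \<tau>': "\<tau>' \<in> fpf_involutions A'"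
    using fpf_involutions_remove_pair[OF Suc.prems(3) a] by (simp add: \<tau>'_def A'_def b_def)
  have \<tau>: "\<tau> = transposition a b \<circ> \<tau>'" by (simp add: \<tau>'_def fun_eq_iff)
  have ab: "b \<in> A" "a \<noteq> b"
    using fpf_involutionsD(3,5)[OF Suc.prems(3), of a] a by (auto simp: b_def)
  then have A: "A = insert a (insert b A')" "a \<notin> A'" "b \<notin> A'" "finite A'"
    using a Suc.prems(1) by (auto simp: A'_def)
  have card: "card A' = 2 * m" using Suc.prems(2) A ab by simp
  let ?f = "\<lambda>c \<rho>. transposition b c \<circ> (transposition a b \<circ> \<rho>) \<circ> transposition b c"
  let ?S = "\<Sum>\<rho>\<in>fpf_involutions A'. monom 1 (num_cycles A' (\<rho> \<circ> \<tau>')) :: 'b poly"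
  have "(\<Sum>p\<in>fpf_involutions A. monom 1 (num_cycles A (p \<circ> \<tau>)) :: 'b poly)
      = (\<Sum>(c, \<rho>)\<in>insert b A' \<times> fpf_involutions A'. monom 1 (num_cycles A (?f c \<rho> \<circ> \<tau>)))"
    using sum.reindex_bij_betw[OF fpf_involutions_bij_betw_remove_pair[OF A(2,3) ab(2)],
        of "\<lambda>p. monom 1 (num_cycles A (p \<circ> \<tau>)) :: 'b poly"]
    by (simp add: A(1)[symmetric] case_prod_beta)
  also have "\<dots> = (\<Sum>c\<in>insert b A'. \<Sum>\<rho>\<in>fpf_involutions A'.
      monom 1 (if c = b then 2 else 0) * monom 1 (num_cycles A' (\<rho> \<circ> \<tau>')))"
    unfolding sum.cartesian_product[symmetric]
  proof (intro sum.cong refl)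
    fix c \<rho> assume *: "c \<in> insert b A'" "\<rho> \<in> fpf_involutions A'"
    show "monom 1 (num_cycles A (?f c \<rho> \<circ> \<tau>))
      = (monom 1 (if c = b then 2 else 0) * monom 1 (num_cycles A' (\<rho> \<circ> \<tau>')) :: 'b poly)"
      unfolding \<tau> A(1) num_cycles_remove_pair[OF A(4,2,3) ab(2) * \<tau>']
      by (simp add: mult_monom add.commute)
  qed
  also have "\<dots> = (\<Sum>c\<in>insert b A'. monom 1 (if c = b then 2 else 0)) * ?S"
    unfolding sum_product ..
  also have "(\<Sum>c\<in>insert b A'. monom 1 (if c = b then 2 else 0) :: 'b poly)
      = monom 1 2 + (\<Sum>c\<in>A'. monom 1 0)"
  proof -
    have "(\<Sum>c\<in>A'. monom 1 (if c = b then 2 else 0) :: 'b poly) = (\<Sum>c\<in>A'. monom 1 0)"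
      using A(3) by (intro sum.cong) auto
    then show ?thesis using A(3,4) by simp
  qed
  also have "(\<Sum>c\<in>A'. monom 1 0 :: 'b poly) = [:2 * of_nat m:]"
    by (simp add: card monom_0 of_nat_poly)
  also have "?S = (\<Prod>k<m. monom 1 2 + [:2 * of_nat k:])"
    by (rule Suc.IH[OF A(4) card \<tau>'])
  finally show ?case by (simp add: mult.commute)
qed



section \<open>Probability generating polynomials\<close>

text \<open>The law of a sum of independent variables is the convolution of their laws, which is how the
  coefficients of polynomials multiply.\<close>

lemma (in prob_space) prob_sum_eq_coeff_prod:
  fixes X :: "'i \<Rightarrow> 'a \<Rightarrow> nat" and q :: "'i \<Rightarrow> real poly"
  assumes "finite I" "indep_vars (\<lambda>_. count_space UNIV) X I"
    and "\<And>i n. i \<in> I \<Longrightarrow> prob {\<omega> \<in> space M. X i \<omega> = n} = coeff (q i) n"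
  shows "prob {\<omega> \<in> space M. (\<Sum>i\<in>I. X i \<omega>) = n} = coeff (\<Prod>i\<in>I. q i) n"
  using assms
proof (induction I arbitrary: n rule: finite_induct)
  case empty
  then show ?case by (simp add: prob_space)
next
  case (insert i I)
  let ?S = "\<lambda>\<omega>. \<Sum>i\<in>I. X i \<omega>"
  have IH: "prob {\<omega> \<in> space M. ?S \<omega> = m} = coeff (\<Prod>i\<in>I. q i) m" for m
    using insert.prems by (intro insert.IH) (auto intro: indep_vars_subset)
  have rv: "X j \<in> measurable M (count_space UNIV)" if "j \<in> insert i I" for j
    using insert.prems(1) that by (auto simp: indep_vars_def2)
  \<comment> \<open>\<open>indep_vars_sum\<close> is about real variables, hence the passage through \<open>real\<close>.\<close>
  have "indep_vars (\<lambda>_. borel) (\<lambda>j \<omega>. real (X j \<omega>)) (insert i I)"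
    by (rule indep_vars_compose2[OF insert.prems(1)]) simp
  then have indep: "indep_var borel (\<lambda>\<omega>. real (X i \<omega>)) borel (\<lambda>\<omega>. \<Sum>i\<in>I. real (X i \<omega>))"
    using insert.hyps by (intro indep_vars_sum) auto
  have split: "prob {\<omega> \<in> space M. X i \<omega> = k \<and> ?S \<omega> = m}
      = coeff (q i) k * coeff (\<Prod>i\<in>I. q i) m" for k m
  proof -
    have *: "(\<lambda>\<omega>. real (X i \<omega>)) -` {real k} \<inter> space M = {\<omega> \<in> space M. X i \<omega> = k}"
      "(\<lambda>\<omega>. \<Sum>i\<in>I. real (X i \<omega>)) -` {real m} \<inter> space M = {\<omega> \<in> space M. ?S \<omega> = m}"
      "(\<lambda>\<omega>. (real (X i \<omega>), \<Sum>i\<in>I. real (X i \<omega>))) -` ({real k} \<times> {real m}) \<inter> space M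
        = {\<omega> \<in> space M. X i \<omega> = k \<and> ?S \<omega> = m}"
      by (auto simp flip: of_nat_sum)
    show ?thesis
      using indep_varD[OF indep, of "{real k}" "{real m}"] unfolding *
      by (simp add: IH insert.prems(2))
  qed
  have meas [measurable]: "X i \<in> measurable M (count_space UNIV)"
      "?S \<in> measurable M (count_space UNIV)"
    using rv by (auto intro!: measurable_sum_nat)
  have "prob {\<omega> \<in> space M. (\<Sum>i\<in>insert i I. X i \<omega>) = n}
      = prob (\<Union>k\<in>{..n}. {\<omega> \<in> space M. X i \<omega> = k \<and> ?S \<omega> = n - k})"
    using insert.hyps by (intro arg_cong[where f = prob]) auto
  also have "\<dots> = (\<Sum>k\<le>n. prob {\<omega> \<in> space M. X i \<omega> = k \<and> ?S \<omega> = n - k})"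
    by (intro finite_measure_finite_Union) (auto simp: disjoint_family_on_def)
  also have "\<dots> = coeff (q i * (\<Prod>i\<in>I. q i)) n"
    by (simp add: split coeff_mult)
  finally show ?case using insert.hyps by simp
qed

text \<open>The two given probabilities add up to \<open>1\<close>, so \<open>B\<close> almost surely takes no third value.\<close>

lemma (in prob_space) prob_twice_bernoulli:
  fixes B :: "'a \<Rightarrow> nat"
  assumes [measurable]: "B \<in> measurable M (count_space UNIV)"
    and "prob {\<omega> \<in> space M. B \<omega> = 1} = p" "prob {\<omega> \<in> space M. B \<omega> = 0} = 1 - p"
  shows "prob {\<omega> \<in> space M. 2 * B \<omega> = n} = coeff (monom p 2 + [:1 - p:]) n"
proof -
  have "prob {\<omega> \<in> space M. B \<omega> = 0 \<or> B \<omega> = 1}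
      = prob ({\<omega> \<in> space M. B \<omega> = 0} \<union> {\<omega> \<in> space M. B \<omega> = 1})"
    by (intro arg_cong[where f = prob]) auto
  also have "\<dots> = 1"
    using assms(2,3) by (subst finite_measure_Union) auto
  finally have ae: "AE \<omega> in M. B \<omega> = 0 \<or> B \<omega> = 1"
    by (subst prob_Collect_eq_1[symmetric]) auto
  consider "n = 0" | "n = 2" | "n \<noteq> 0" "n \<noteq> 2" by auto
  then show ?thesis
  proof cases
    case 1
    then show ?thesis using assms(3) by simp
  next
    case 2
    then have "2 * B \<omega> = n \<longleftrightarrow> B \<omega> = 1" for \<omega> by auto
    then show ?thesis using assms(2) 2 by (simp add: coeff_pCons numeral_2_eq_2)
  next
    case 3
    then have "prob {\<omega> \<in> space M. 2 * B \<omega> = n} = 0"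
      using ae by (subst prob_eq_0) (auto elim!: eventually_mono)
    then show ?thesis using 3 by (simp add: coeff_pCons split: nat.split)
  qed
qed

lemma coeff_expectation_poly_monom:
  assumes "finite (set_pmf p)"
  shows "coeff (expectation_poly p (\<lambda>x. monom 1 (f x))) n = measure_pmf.prob p (f -` {n})"
proof -
  have "measure_pmf.prob p (f -` {n}) = measure_pmf.prob p (f -` {n} \<inter> set_pmf p)"
    by (rule measure_Int_set_pmf[symmetric])
  also have "\<dots> = (\<Sum>x\<in>f -` {n} \<inter> set_pmf p. pmf p x)"
    using assms by (intro measure_measure_pmf_finite) auto
  also have "\<dots> = (\<Sum>x\<in>set_pmf p. if f x = n then pmf p x else 0)"
    using assms by (subst Int_commute, subst sum.inter_restrict) (auto intro!: sum.cong)
  finally show ?thesis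
    by (simp add: expectation_poly_def coeff_sum if_distrib cong: if_cong)
qed

section \<open>The commutator with a fixed-point-free involution\<close>

lemma pair_involution_Suc:
  "pair_involution (Suc M) = pair_involution M \<circ> transposition (2 * M + 1) (2 * M + 2)"
proof -
  have "foldr (\<circ>) fs f = foldr (\<circ>) fs id \<circ> f" for fs and f :: "nat \<Rightarrow> nat"
    by (induction fs) (auto simp: o_assoc)
  from this[of _ "transposition (2 * M + 1) (2 * M + 2)"] show ?thesis
    by (simp add: pair_involution_def)
qed

lemma pair_involution_fpf: "pair_involution M \<in> fpf_involutions {1..2 * M}"
proof (induction M)
  case 0
  then show ?case by (simp add: pair_involution_def fpf_involutions_empty id_def)
next
  case (Suc M)
  let ?t = "transposition (2 * M + 1) (2 * M + 2)"
  have A: "insert (2 * M + 1) (insert (2 * M + 2) {1..2 * M}) = {1..2 * Suc M}" by auto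
  have "?t \<circ> pair_involution M \<in> fpf_involutions {1..2 * Suc M}"
    using fpf_involutions_add_pair[OF Suc, of "2 * M + 1" "2 * M + 2"] unfolding A by simp
  moreover have "?t permutes {1..2 * Suc M}" by (intro permutes_swap_id) auto
  ultimately have "?t \<circ> (?t \<circ> pair_involution M) \<circ> inv ?t \<in> fpf_involutions {1..2 * Suc M}"
    by (rule fpf_involutions_conj)
  \<comment> \<open>Conjugation by the new transposition moves it from the left factor to the right one.\<close>
  moreover have "?t \<circ> (?t \<circ> pair_involution M) \<circ> inv ?t = pair_involution (Suc M)"
    by (simp add: pair_involution_Suc fun_eq_iff)
  ultimately show ?case by simp
qed

text \<open>The size \<open>N\<close> of the centraliser of \<open>\<tau>\<close> cancels: counting all permutations by the conjugate of
  \<open>\<tau>\<close> that they produce gives \<open>(2 * M)! = N * (1 * 3 * \<dots> * (2 * M - 1))\<close>.\<close>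

lemma expectation_poly_num_cycles_commutator:
  assumes "\<tau> \<in> fpf_involutions {1..2 * M}"
  shows "expectation_poly (uniform_perm (2 * M))
      (\<lambda>\<sigma>. monom 1 (num_cycles {1..2 * M} (commutator \<sigma> \<tau>)))
    = (\<Prod>k<M. smult (1 / (2 * real k + 1)) (monom 1 2 + [:2 * real k:]))"
proof -
  let ?A = "{1..2 * M}" and ?P = "\<Prod>k<M. monom 1 2 + [:2 * real k:]"
  define N where "N = card {\<sigma>. \<sigma> permutes ?A \<and> \<sigma> \<circ> \<tau> = \<tau> \<circ> \<sigma>}"
  have cycles: "(\<Sum>p\<in>fpf_involutions ?A. monom 1 (num_cycles ?A (p \<circ> \<tau>))) = ?P"
    using assms by (intro sum_monom_num_cycles_fpf_involutions) auto
  have "real (card (fpf_involutions ?A)) = poly (\<Sum>p\<in>fpf_involutions ?A. monom 1 (num_cycles ?A (p \<circ> \<tau>))) 1"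
    by (simp add: poly_sum poly_monom)
  also have "\<dots> = (\<Prod>k<M. 2 * real k + 1)"
    unfolding cycles by (simp add: poly_prod poly_monom add.commute)
  finally have card: "real (card (fpf_involutions ?A)) = (\<Prod>k<M. 2 * real k + 1)" .
  have perms: "card {\<sigma>. \<sigma> permutes ?A} = fact (2 * M)" "finite {\<sigma>. \<sigma> permutes ?A}"
    "{\<sigma>. \<sigma> permutes ?A} \<noteq> {}"
    using permutes_id[of ?A] by (simp add: card_permutations, simp add: finite_permutations, blast)
  have N: "fact (2 * M) = real N * (\<Prod>k<M. 2 * real k + 1)"
    using sum_conjugates[OF _ assms, of "\<lambda>_. 1 :: real"] perms(1) card by (simp add: N_def)
  then have "real N \<noteq> 0"
    using fact_nonzero[of "2 * M", where 'a = real] by (metis mult_zero_left)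
  have "expectation_poly (uniform_perm (2 * M)) (\<lambda>\<sigma>. monom 1 (num_cycles ?A (commutator \<sigma> \<tau>)))
      = (\<Sum>\<sigma> | \<sigma> permutes ?A. smult (1 / fact (2 * M)) (monom 1 (num_cycles ?A (\<sigma> \<circ> \<tau> \<circ> inv \<sigma> \<circ> \<tau>))))"
    using perms fpf_involutionsD(6)[OF assms]
    by (simp add: expectation_poly_def uniform_perm_def set_pmf_of_set commutator_def)
  also have "\<dots> = smult (1 / fact (2 * M)) (\<Sum>\<sigma> | \<sigma> permutes ?A. monom 1 (num_cycles ?A (\<sigma> \<circ> \<tau> \<circ> inv \<sigma> \<circ> \<tau>)))"
    using sum_distrib_left[of "[:1 / fact (2 * M):]", symmetric] by simp
  also have "\<dots> = smult (1 / fact (2 * M)) (of_nat N * ?P)"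
    unfolding N_def
    by (subst sum_conjugates[OF _ assms, of "\<lambda>p. monom 1 (num_cycles ?A (p \<circ> \<tau>))"])
      (simp_all only: cycles finite_atLeastAtMost)
  also have "\<dots> = smult (real N / fact (2 * M)) ?P"
    by (simp add: of_nat_poly)
  also have "real N / fact (2 * M) = (\<Prod>k<M. 1 / (2 * real k + 1))"
    unfolding N using \<open>real N \<noteq> 0\<close> by (simp add: prod_dividef)
  also have "smult \<dots> ?P = (\<Prod>k<M. smult (1 / (2 * real k + 1)) (monom 1 2 + [:2 * real k:]))"
    by (rule prod_smult[symmetric])
  finally show ?thesis .
qed

text \<open>Both sides gain the factor \<open>2 / (2 * M + 1) * (t\<^sup>2 / 2 + M)\<close> in passing from \<open>M\<close> to \<open>M + 1\<close>.\<close>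

lemma rising_factorial_poly_pcompose:
  "smult (4 ^ M * fact M / fact (2 * M)) (pcompose (rising_factorial_poly M) (monom (1 / 2) 2))
    = (\<Prod>k<M. smult (1 / (2 * real k + 1)) (monom 1 2 + [:2 * real k:]))"
proof (induction M)
  case 0
  then show ?case by (simp add: rising_factorial_poly_def pcompose_1)
next
  case (Suc M)
  let ?c = "\<lambda>M. 4 ^ M * fact M / fact (2 * M) :: real"
  let ?q = "pcompose (rising_factorial_poly M) (monom (1 / 2) 2)"
  have c: "?c (Suc M) = ?c M * (2 / (2 * real M + 1))"
  proof -
    have "fact (2 * Suc M) = (2 * real M + 2) * (2 * real M + 1) * (fact (2 * M) :: real)"
      by (simp add: algebra_simps)
    moreover have "fact (Suc M) = (2 * real M + 2) / 2 * (fact M :: real)"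
      by (simp add: field_simps)
    moreover have "4 * x * (u / 2 * y) / (u * v * z) = x * y / z * (2 / v)"
      if "u \<noteq> 0" for u v x y z :: real
      using that by (simp add: mult_ac)
    moreover have "2 * real M + 2 \<noteq> 0" by linarith
    ultimately show ?thesis by (simp only: power_Suc)
  qed
  have "rising_factorial_poly (Suc M) = rising_factorial_poly M * [:real M, 1:]"
    by (simp only: rising_factorial_poly_def prod.lessThan_Suc)
  then have "pcompose (rising_factorial_poly (Suc M)) (monom (1 / 2) 2)
      = ?q * (monom (1 / 2) 2 + [:real M:])"
    by (simp only: pcompose_mult) (simp add: pcompose_pCons add.commute)
  also have "monom (1 / 2) 2 + [:real M:] = smult (1 / 2) (monom 1 2 + [:2 * real M:])"
    by (simp add: smult_add_right smult_monom)
  finally have "smult (?c (Suc M)) (pcompose (rising_factorial_poly (Suc M)) (monom (1 / 2) 2))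
      = smult (?c M) ?q * smult (1 / (2 * real M + 1)) (monom 1 2 + [:2 * real M:])"
    unfolding c by (simp add: mult.commute)
  then show ?case unfolding Suc.IH by simp
qed

theorem theorem4:
  fixes M :: nat
  assumes "M \<ge> 1"
  shows "(expectation_poly (uniform_perm (2 * M))
           (\<lambda>\<sigma>. monom 1 (num_cycles {1..2 * M} (commutator \<sigma> (pair_involution M))))
         = smult (4 ^ M * fact M / fact (2 * M))
             (pcompose (rising_factorial_poly M) (monom (1 / 2) 2)))
         \<and>
         (\<forall>(\<Omega> :: 'w measure) (B :: nat \<Rightarrow> 'w \<Rightarrow> nat).
           prob_space \<Omega> \<longrightarrow>
           prob_space.indep_vars \<Omega> (\<lambda>_. count_space UNIV) B {1..} \<longrightarrow>
           (\<forall>k\<ge>1. measure \<Omega> {\<omega> \<in> space \<Omega>. B k \<omega> = 1} = 1 / (2 * real k - 1) \<and>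
                   1 / (2 * real k - 1) = 1 - measure \<Omega> {\<omega> \<in> space \<Omega>. B k \<omega> = 0}) \<longrightarrow>
           distr (measure_pmf (uniform_perm (2 * M))) (count_space UNIV)
             (\<lambda>\<sigma>. num_cycles {1..2 * M} (commutator \<sigma> (pair_involution M)))
           = distr \<Omega> (count_space UNIV) (\<lambda>\<omega>. 2 * (\<Sum>k = 1..M. B k \<omega>)))"
proof (intro conjI allI impI)
  let ?N = "\<lambda>\<sigma>. num_cycles {1..2 * M} (commutator \<sigma> (pair_involution M))"
  let ?U = "measure_pmf (uniform_perm (2 * M))"
  let ?E = "expectation_poly (uniform_perm (2 * M)) (\<lambda>\<sigma>. monom 1 (?N \<sigma>))"
  note E = expectation_poly_num_cycles_commutator[OF pair_involution_fpf]
  show "?E = smult (4 ^ M * fact M / fact (2 * M))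
      (pcompose (rising_factorial_poly M) (monom (1 / 2) 2))"
    unfolding E rising_factorial_poly_pcompose ..
  fix \<Omega> :: "'w measure" and B :: "nat \<Rightarrow> 'w \<Rightarrow> nat"
  assume \<Omega>: "prob_space \<Omega>"
    and indep: "prob_space.indep_vars \<Omega> (\<lambda>_. count_space UNIV) B {1..}"
    and B: "\<forall>k\<ge>1. measure \<Omega> {\<omega> \<in> space \<Omega>. B k \<omega> = 1} = 1 / (2 * real k - 1) \<and>
      1 / (2 * real k - 1) = 1 - measure \<Omega> {\<omega> \<in> space \<Omega>. B k \<omega> = 0}"
  interpret prob_space \<Omega> by (rule \<Omega>)
  have rv: "B k \<in> measurable \<Omega> (count_space UNIV)" if "k \<ge> 1" for k
    using indep that by (auto simp: indep_vars_def2)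
  let ?q = "\<lambda>k. monom (1 / (2 * real k - 1)) 2 + [:1 - 1 / (2 * real k - 1):]"
  have "indep_vars (\<lambda>_. count_space UNIV) (\<lambda>k \<omega>. 2 * B k \<omega>) {1..M}"
    by (rule indep_vars_compose2[OF indep_vars_subset[OF indep]]) auto
  then have sum: "prob {\<omega> \<in> space \<Omega>. (\<Sum>k\<in>{1..M}. 2 * B k \<omega>) = n} = coeff (\<Prod>k\<in>{1..M}. ?q k) n" for n
  proof (rule prob_sum_eq_coeff_prod[OF finite_atLeastAtMost])
    fix k n assume "k \<in> {1..M}"
    then show "prob {\<omega> \<in> space \<Omega>. 2 * B k \<omega> = n} = coeff (?q k) n"
      using B rv[of k] by (intro prob_twice_bernoulli) auto
  qed
  have "(\<Prod>k\<in>{1..M}. ?q k) = ?E"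
    unfolding E unfolding One_nat_def prod.atLeast1_atMost_eq
  proof (rule prod.cong)
    fix k
    have k: "2 * real (Suc k) - 1 = 2 * real k + 1" by simp
    have eq: "1 - 1 / (2 * real k + 1) = 2 * real k / (2 * real k + 1)"
      by (simp add: field_simps)
    then show "?q (Suc k) = smult (1 / (2 * real k + 1)) (monom 1 2 + [:2 * real k:])"
      unfolding k eq by (simp add: smult_add_right smult_monom)
  qed simp
  with sum have law: "prob {\<omega> \<in> space \<Omega>. 2 * (\<Sum>k = 1..M. B k \<omega>) = n} = measure ?U (?N -` {n})" for n
    by (simp add: sum_distrib_left coeff_expectation_poly_monom finite_set_pmf_uniform_perm)
  have S: "(\<lambda>\<omega>. 2 * (\<Sum>k = 1..M. B k \<omega>)) \<in> measurable \<Omega> (count_space UNIV)"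
    using rv by measurable
  show "distr ?U (count_space UNIV) ?N = distr \<Omega> (count_space UNIV) (\<lambda>\<omega>. 2 * (\<Sum>k = 1..M. B k \<omega>))"
  proof (rule measure_eqI_countable[of _ UNIV])
    fix n :: nat
    have "emeasure (distr ?U (count_space UNIV) ?N) {n} = emeasure ?U (?N -` {n})"
      by (simp add: emeasure_distr)
    moreover have "emeasure (distr \<Omega> (count_space UNIV) (\<lambda>\<omega>. 2 * (\<Sum>k = 1..M. B k \<omega>))) {n}
        = emeasure \<Omega> {\<omega> \<in> space \<Omega>. 2 * (\<Sum>k = 1..M. B k \<omega>) = n}"
      using S by (subst emeasure_distr) (auto intro!: arg_cong[where f = "emeasure \<Omega>"])
    ultimately show "emeasure (distr ?U (count_space UNIV) ?N) {n}
        = emeasure (distr \<Omega> (count_space UNIV) (\<lambda>\<omega>. 2 * (\<Sum>k = 1..M. B k \<omega>))) {n}"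
      using law[of n] by (simp add: emeasure_eq_measure measure_pmf.emeasure_eq_measure)
  qed auto
qed

end
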